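(* Let $h$ be a function which, in a neighbourhood of the points $\mu_i,\mu_{i+1},\dots,\mu_{i+m}$ (where $m\ge 0$, $1\le i$, $i+m\le n$), is a polynomial of the form $$h(\lambda)=\sum_{\alpha=0}^{k+\gamma}c_\alpha(\lambda-\bar\mu)^\alpha ,\qquad c_\alpha\in\mathbb C .$$ Then the divided differences of $h$ possess the representation $$\Delta_i^{i+m}h=\sum_{\alpha=m}^{k+\gamma}c_{\alpha}\,\sigma_{\alpha-m}(\xi_i,\xi_{i+1},\dots,\xi_{i+m})=c_m+\sum_{\alpha=m+1}^{k+\gamma}c_{\alpha}\,\sigma_{\alpha-m}(\xi_i,\xi_{i+1},\dots,\xi_{i+m}),$$ where $\xi_s=\mu_s-\bar\mu$ and the homogeneous polynomials $\sigma_\alpha$ are defined by $$\sigma_0(\xi_i,\xi_{i+1},\dots,\xi_{i+m})=1,\qquad \sigma_\alpha(\xi_i,\xi_{i+1},\dots,\xi_{i+m})=\sum_{i_0+i_1+\dots+i_m=\alpha}\xi_i^{i_0}\xi_{i+1}^{i_1}\cdots\xi_{i+m}^{i_m},$$ the sum being over all nonnegative integers $i_0,\dots,i_m$ with $i_0+\dots+i_m=\alpha$. In particular, the divided differences of the function $h$ do not contain differences of close numbers in denominators (in this representation).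
   Context: Setting. Let $\mu_1,\dots,\mu_n\in\mathbb C$ be given points, some of which may coincide. Some $k$ of them, $\mu_{l+1},\mu_{l+2},\dots,\mu_{l+k}$ (with $l\ge 0$, $k\ge 1$, $l+k\le n$), are situated close to each other (some of them may coincide), and the remaining points lie far apart from these $k$ points; "differences of close numbers" refers to differences of such close points. Put $\bar\mu=\frac1k(\mu_{l+1}+\mu_{l+2}+\dots+\mu_{l+k})$, and let $\gamma\in\{-1,0,1,\dots\}$. Divided differences. For a complex-valued function $f$ analytic in a neighbourhood of the points, the divided differences are defined recursively by $$\Delta_i^{i}f=f^{[0]}(\mu_i)=f(\mu_i),$$ $$\Delta_i^{i+m}f=f^{[m]}(\mu_i,\dots,\mu_{i+m})=\frac{f^{[m-1]}(\mu_{i+1},\dots,\mu_{i+m})-f^{[m-1]}(\mu_{i},\dots,\mu_{i+m-1})}{\mu_{i+m}-\mu_i},\qquad m\ge 1.$$ If the denominator vanishes, the quotient means the derivative of the previous divided difference with respect to one of its arguments (the value obtained by continuity). Conventions: an empty sum equals $0$, and $c_\alpha=0$ for $\alpha>k+\gamma$. *)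

theory Defs
  imports "HOL-Analysis.Analysis"
begin

text \<open>
  \<open>divdiff f m x\<close> is the divided difference $f^{[m]}(x_0,\dots,x_m)$; only the values
  \<open>x 0, \<dots>, x m\<close> are used. If \<open>x (Suc m) = x 0\<close>, the quotient is read as its limit by
  continuity, the derivative of the previous divided difference $f^{[m]}(w,x_1,\dots,x_m)$ with
  respect to its first argument at \<open>w = x 0\<close>.
\<close>

primrec divdiff :: "(complex \<Rightarrow> complex) \<Rightarrow> nat \<Rightarrow> (nat \<Rightarrow> complex) \<Rightarrow> complex" where
  "divdiff f 0 x = f (x 0)"
| "divdiff f (Suc m) x =
     (if x (Suc m) = x 0
      then deriv (\<lambda>w. divdiff f m (x(0 := w))) (x 0)
      else (divdiff f m (\<lambda>s. x (Suc s)) - divdiff f m x) / (x (Suc m) - x 0))"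

text \<open>\<open>Delta \<mu> i j f\<close> is $\Delta_i^j f = f^{[j-i]}(\mu_i,\dots,\mu_j)$, meant for \<open>i \<le> j\<close>.\<close>

definition Delta :: "(nat \<Rightarrow> complex) \<Rightarrow> nat \<Rightarrow> nat \<Rightarrow> (complex \<Rightarrow> complex) \<Rightarrow> complex" where
  "Delta \<mu> i j f = divdiff f (j - i) (\<lambda>s. \<mu> (i + s))"

text \<open>
  \<open>sigma_poly \<alpha> i j \<xi>\<close> is $\sigma_\alpha(\xi_i,\dots,\xi_j)$. A tuple of exponents is an extensional
  function \<open>e\<close> on \<open>{i..j}\<close>, the exponent of \<open>\<xi> s\<close> being \<open>e s\<close>; extensionality makes every tuple
  occur exactly once.
\<close>

definition sigma_poly :: "nat \<Rightarrow> nat \<Rightarrow> nat \<Rightarrow> (nat \<Rightarrow> complex) \<Rightarrow> complex" where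
  "sigma_poly \<alpha> i j \<xi> =
     (\<Sum>e | e \<in> {i..j} \<rightarrow>\<^sub>E UNIV \<and> (\<Sum>s=i..j. e s) = \<alpha>. \<Prod>s=i..j. \<xi> s ^ e s)"

lemma finite_sigma_poly_exponents:
  "finite {e :: nat \<Rightarrow> nat. e \<in> {i..j} \<rightarrow>\<^sub>E UNIV \<and> (\<Sum>s=i..j. e s) = \<alpha>}"
proof (rule finite_subset)
  show "{e :: nat \<Rightarrow> nat. e \<in> {i..j} \<rightarrow>\<^sub>E UNIV \<and> (\<Sum>s=i..j. e s) = \<alpha>}
          \<subseteq> {i..j} \<rightarrow>\<^sub>E {..\<alpha>}"
    by (auto simp: PiE_iff extensional_def intro: member_le_sum)
qed (intro finite_PiE; simp)

lemma sigma_poly_0: "sigma_poly 0 i j \<xi> = 1"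
proof -
  have "{e :: nat \<Rightarrow> nat. e \<in> {i..j} \<rightarrow>\<^sub>E UNIV \<and> (\<Sum>s=i..j. e s) = 0}
          = {\<lambda>s\<in>{i..j}. 0}"
    by (auto simp: PiE_iff extensional_def restrict_def fun_eq_iff)
  then show ?thesis
    by (simp add: sigma_poly_def)
qed

text \<open>
  The functions of \<open>(\<xi> s)\<close>, \<open>s \<in> S\<close>, that can be written without division, i.e. the polynomials
  in these variables.
\<close>

inductive division_free :: "nat set \<Rightarrow> ((nat \<Rightarrow> complex) \<Rightarrow> complex) \<Rightarrow> bool"
  for S :: "nat set" where
  const: "division_free S (\<lambda>\<xi>. a)"
| var: "s \<in> S \<Longrightarrow> division_free S (\<lambda>\<xi>. \<xi> s)"
| add: "division_free S p \<Longrightarrow> division_free S q \<Longrightarrow> division_free S (\<lambda>\<xi>. p \<xi> + q \<xi>)"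
| mult: "division_free S p \<Longrightarrow> division_free S q \<Longrightarrow> division_free S (\<lambda>\<xi>. p \<xi> * q \<xi>)"

end

theory Submission
  imports Defs
begin

text \<open>
  The complete homogeneous polynomials satisfy
  $\sigma_{\alpha+1}(X, \xi_s) = \sigma_{\alpha+1}(X) + \xi_s\,\sigma_\alpha(X, \xi_s)$ for every list
  of variables $X$. Removing either the first or the last variable from
  $\sigma_{\alpha+1}(\xi_0,\dots,\xi_{m+1})$ and comparing gives
  $\sigma_{\alpha+1}(\xi_1,\dots,\xi_{m+1}) - \sigma_{\alpha+1}(\xi_0,\dots,\xi_m)
    = (\xi_{m+1} - \xi_0)\,\sigma_\alpha(\xi_0,\dots,\xi_{m+1})$,
  which is exactly the recursion of the divided differences of $(\lambda - \bar\mu)^\alpha$. Since the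
  right-hand factor is continuous, the same identity yields the derivative needed at coinciding nodes.
\<close>

section \<open>Complete homogeneous polynomials over finite index sets\<close>

text \<open>Arbitrary index sets replace the intervals of \<open>sigma_poly\<close>, so that a
  variable can be adjoined at either end and the indices can be shifted or permuted.\<close>

definition complete_homogeneous :: "nat set \<Rightarrow> nat \<Rightarrow> (nat \<Rightarrow> complex) \<Rightarrow> complex" where
  "complete_homogeneous A \<alpha> \<xi> =
     (\<Sum>e | e \<in> A \<rightarrow>\<^sub>E UNIV \<and> sum e A = \<alpha>. \<Prod>s\<in>A. \<xi> s ^ e s)"

lemma sigma_poly_eq_complete_homogeneous:
  "sigma_poly \<alpha> i j \<xi> = complete_homogeneous {i..j} \<alpha> \<xi>"
  by (simp add: sigma_poly_def complete_homogeneous_def)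

lemma finite_exponents:
  assumes "finite A"
  shows "finite {e :: nat \<Rightarrow> nat. e \<in> A \<rightarrow>\<^sub>E UNIV \<and> sum e A = \<alpha>}"
proof (rule finite_subset)
  show "{e :: nat \<Rightarrow> nat. e \<in> A \<rightarrow>\<^sub>E UNIV \<and> sum e A = \<alpha>} \<subseteq> A \<rightarrow>\<^sub>E {..\<alpha>}"
    using assms by (auto simp: PiE_iff extensional_def intro: member_le_sum)
qed (use assms in \<open>intro finite_PiE; simp\<close>)

lemma complete_homogeneous_0:
  assumes "finite A"
  shows "complete_homogeneous A 0 \<xi> = 1"
proof -
  have "{e :: nat \<Rightarrow> nat. e \<in> A \<rightarrow>\<^sub>E UNIV \<and> sum e A = 0} = {\<lambda>s\<in>A. 0}"
    using assms by (auto simp: PiE_iff extensional_def restrict_def fun_eq_iff)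
  then show ?thesis
    by (simp add: complete_homogeneous_def)
qed

lemma complete_homogeneous_empty_Suc: "complete_homogeneous {} (Suc \<alpha>) \<xi> = 0"
  by (simp add: complete_homogeneous_def)

lemma complete_homogeneous_cong:
  assumes "\<And>s. s \<in> A \<Longrightarrow> \<xi> s = \<eta> s"
  shows "complete_homogeneous A \<alpha> \<xi> = complete_homogeneous A \<alpha> \<eta>"
  unfolding complete_homogeneous_def using assms by (intro sum.cong prod.cong) auto

text \<open>Monomials of degree \<open>Suc \<alpha>\<close> either avoid the variable at
  \<open>s\<close>, and are then monomials over \<open>A\<close>, or are that variable times an
  arbitrary monomial of degree \<alpha> over \<open>insert s A\<close>.\<close>

lemma complete_homogeneous_insert_Suc:
  assumes "finite A" and "s \<notin> A"
  shows "complete_homogeneous (insert s A) (Suc \<alpha>) \<xi>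
           = complete_homogeneous A (Suc \<alpha>) \<xi> + \<xi> s * complete_homogeneous (insert s A) \<alpha> \<xi>"
proof -
  define E :: "nat set \<Rightarrow> nat \<Rightarrow> (nat \<Rightarrow> nat) set"
    where "E = (\<lambda>B \<beta>. {e. e \<in> B \<rightarrow>\<^sub>E UNIV \<and> sum e B = \<beta>})"
  define p where "p = (\<lambda>B e. \<Prod>t\<in>B. \<xi> t ^ e t)"
  have upd: "sum (e(s := a)) A = sum e A" "p A (e(s := a)) = p A e" for e :: "nat \<Rightarrow> nat" and a
    unfolding p_def using assms(2) by (auto intro!: sum.cong prod.cong)
  have fin: "finite (E (insert s A) (Suc \<alpha>))"
    unfolding E_def using assms(1) by (intro finite_exponents) simp
  have split: "sum (p (insert s A)) (E (insert s A) (Suc \<alpha>))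
      = sum (p (insert s A)) {e \<in> E (insert s A) (Suc \<alpha>). e s = 0}
        + sum (p (insert s A)) {e \<in> E (insert s A) (Suc \<alpha>). e s \<noteq> 0}"
    using fin by (subst sum.union_disjoint[symmetric]) (auto intro: sum.cong)
  have zero: "sum (p (insert s A)) {e \<in> E (insert s A) (Suc \<alpha>). e s = 0} = sum (p A) (E A (Suc \<alpha>))"
  \<comment> \<open>Extensional tuples on \<open>A\<close> take the value \<open>undefined\<close>
    at \<open>s\<close>, so forgetting the exponent 0 means overwriting it by
    \<open>undefined\<close>.\<close>
  proof (rule sum.reindex_bij_witness[where i = "\<lambda>e. e(s := 0)" and j = "\<lambda>e. e(s := undefined)"])
    fix e assume e: "e \<in> {e \<in> E (insert s A) (Suc \<alpha>). e s = 0}"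
    show "(e(s := undefined))(s := 0) = e" using e by auto
    show "e(s := undefined) \<in> E A (Suc \<alpha>)"
      using e assms upd(1)[of e undefined] by (auto simp: E_def PiE_iff extensional_def)
    show "p A (e(s := undefined)) = p (insert s A) e"
      using e assms upd(2)[of e undefined] by (simp add: p_def)
  next
    fix e assume e: "e \<in> E A (Suc \<alpha>)"
    show "(e(s := 0))(s := undefined) = e"
      using e assms(2) by (auto simp: E_def PiE_iff extensional_def)
    show "e(s := 0) \<in> {e \<in> E (insert s A) (Suc \<alpha>). e s = 0}"
      using e assms upd(1)[of e 0] by (auto simp: E_def PiE_iff extensional_def)
  qed
  have pos: "sum (p (insert s A)) {e \<in> E (insert s A) (Suc \<alpha>). e s \<noteq> 0}
      = (\<Sum>e\<in>E (insert s A) \<alpha>. \<xi> s * p (insert s A) e)"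
  \<comment> \<open>The factor \<open>\<xi> s\<close> is split off by lowering its exponent, without
    dividing by it, so \<open>\<xi> s = 0\<close> is no exception.\<close>
  proof (rule sum.reindex_bij_witness[where i = "\<lambda>e. e(s := Suc (e s))" and j = "\<lambda>e. e(s := e s - 1)"])
    fix e assume e: "e \<in> {e \<in> E (insert s A) (Suc \<alpha>). e s \<noteq> 0}"
    then obtain d where d: "e s = Suc d" using not0_implies_Suc by blast
    show "(e(s := e s - 1))(s := Suc ((e(s := e s - 1)) s)) = e" using d by auto
    show "e(s := e s - 1) \<in> E (insert s A) \<alpha>"
      using e d assms upd(1)[of e d] by (auto simp: E_def PiE_iff extensional_def)
    show "\<xi> s * p (insert s A) (e(s := e s - 1)) = p (insert s A) e"
      using d assms upd(2)[of e d] by (simp add: p_def)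
  next
    fix e assume e: "e \<in> E (insert s A) \<alpha>"
    show "(e(s := Suc (e s)))(s := (e(s := Suc (e s))) s - 1) = e" by auto
    show "e(s := Suc (e s)) \<in> {e \<in> E (insert s A) (Suc \<alpha>). e s \<noteq> 0}"
      using e assms upd(1)[of e "Suc (e s)"] by (auto simp: E_def PiE_iff extensional_def)
  qed
  show ?thesis
    using split unfolding zero pos
    by (simp add: complete_homogeneous_def E_def p_def sum_distrib_left)
qed

text \<open>The recurrence for \<open>insert\<close>, together with the value in degree 0,
  determines everything; hence an outer induction on the set and an inner one on the degree.\<close>

lemma complete_homogeneous_image:
  assumes "finite A" and "inj_on f A"
  shows "complete_homogeneous (f ` A) \<alpha> \<xi> = complete_homogeneous A \<alpha> (\<lambda>s. \<xi> (f s))"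
  using assms
proof (induction A arbitrary: \<alpha> rule: finite_induct)
  case empty
  then show ?case by (simp add: complete_homogeneous_def)
next
  case (insert s A)
  have IH: "complete_homogeneous (f ` A) \<beta> \<xi> = complete_homogeneous A \<beta> (\<lambda>s. \<xi> (f s))" for \<beta>
    using insert by simp
  have "f s \<notin> f ` A"
    using insert by auto
  then show ?case
    by (induction \<alpha>)
       (simp_all add: insert.hyps IH complete_homogeneous_0 complete_homogeneous_insert_Suc)
qed

lemma continuous_complete_homogeneous [continuous_intros]:
  fixes F :: "'a::t2_space filter"
  assumes "\<And>s. s \<in> A \<Longrightarrow> continuous F (\<lambda>w. \<xi> w s)"
  shows "continuous F (\<lambda>w. complete_homogeneous A \<alpha> (\<xi> w))"
  unfolding complete_homogeneous_def using assms by (intro continuous_intros)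

lemma complete_homogeneous_diff:
  "complete_homogeneous {1..Suc m} (Suc \<alpha>) \<xi> - complete_homogeneous {0..m} (Suc \<alpha>) \<xi>
     = (\<xi> (Suc m) - \<xi> 0) * complete_homogeneous {0..Suc m} \<alpha> \<xi>"
proof -
  have last: "{0..Suc m} = insert (Suc m) {0..m}" and first: "{0..Suc m} = insert 0 {1..Suc m}"
    by auto
  show ?thesis
    using complete_homogeneous_insert_Suc[of "{0..m}" "Suc m" \<alpha> \<xi>]
      complete_homogeneous_insert_Suc[of "{1..Suc m}" 0 \<alpha> \<xi>]
    unfolding last[symmetric] first[symmetric] by (simp add: algebra_simps)
qed

section \<open>Divided differences of a polynomial in powers of \<open>\<lambda> - b\<close>\<close>

text \<open>This is the closed form to be established, for nodes numbered from 0; \<open>b\<close>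
  stands for the mean of the close points and \<open>N\<close> for
  \<open>k + \<gamma>\<close>.\<close>

definition divdiff_poly ::
    "(nat \<Rightarrow> complex) \<Rightarrow> complex \<Rightarrow> nat \<Rightarrow> nat \<Rightarrow> (nat \<Rightarrow> complex) \<Rightarrow> complex" where
  "divdiff_poly c b N m x =
     (\<Sum>\<alpha>=m..N. c \<alpha> * complete_homogeneous {0..m} (\<alpha> - m) (\<lambda>s. x s - b))"

lemma divdiff_poly_cong:
  assumes "\<And>s. s \<le> m \<Longrightarrow> x s = y s"
  shows "divdiff_poly c b N m x = divdiff_poly c b N m y"
  unfolding divdiff_poly_def
  using assms by (intro sum.cong arg_cong2[where f = times] complete_homogeneous_cong) auto

lemma divdiff_poly_diff:
  "divdiff_poly c b N m (\<lambda>s. x (Suc s)) - divdiff_poly c b N m x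
     = (x (Suc m) - x 0) * divdiff_poly c b N (Suc m) x"
proof -
  let ?\<xi> = "\<lambda>s. x s - b"
  have shift: "complete_homogeneous {0..m} \<beta> (\<lambda>s. x (Suc s) - b)
      = complete_homogeneous {1..Suc m} \<beta> ?\<xi>" for \<beta>
    using complete_homogeneous_image[of "{0..m}" Suc \<beta> ?\<xi>] by (simp add: image_Suc_atLeastAtMost)
  define D where "D = (\<lambda>\<alpha>. c \<alpha> * (complete_homogeneous {1..Suc m} (\<alpha> - m) ?\<xi>
                                 - complete_homogeneous {0..m} (\<alpha> - m) ?\<xi>))"
  have "divdiff_poly c b N m (\<lambda>s. x (Suc s)) - divdiff_poly c b N m x = (\<Sum>\<alpha>=m..N. D \<alpha>)"
    unfolding divdiff_poly_def shift D_def by (simp add: sum_subtractf right_diff_distrib)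
  \<comment> \<open>The term at \<open>\<alpha> = m\<close> is the difference of two polynomials of
    degree 0, both equal to 1, and vanishes.\<close>
  also have "\<dots> = (\<Sum>\<alpha>=Suc m..N. D \<alpha>)"
  proof (rule sum.mono_neutral_right)
    show "\<forall>\<alpha>\<in>{m..N} - {Suc m..N}. D \<alpha> = 0"
    proof
      fix \<alpha> assume "\<alpha> \<in> {m..N} - {Suc m..N}"
      then have "\<alpha> = m" by auto
      then show "D \<alpha> = 0" by (simp add: D_def complete_homogeneous_0)
    qed
  qed auto
  also have "\<dots> = (\<Sum>\<alpha>=Suc m..N. (x (Suc m) - x 0)
                    * (c \<alpha> * complete_homogeneous {0..Suc m} (\<alpha> - Suc m) ?\<xi>))"
  proof (rule sum.cong)
    fix \<alpha> assume "\<alpha> \<in> {Suc m..N}"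
    then have "\<alpha> - m = Suc (\<alpha> - Suc m)" by auto
    then show "D \<alpha> = (x (Suc m) - x 0) * (c \<alpha> * complete_homogeneous {0..Suc m} (\<alpha> - Suc m) ?\<xi>)"
      using complete_homogeneous_diff[of m "\<alpha> - Suc m" ?\<xi>] by (simp add: D_def)
  qed simp
  finally show ?thesis
    by (simp add: divdiff_poly_def sum_distrib_left)
qed

text \<open>The node lists are \<open>x 1, ..., x m, w\<close> and \<open>w, x 1, ..., x m\<close>;
  symmetry in the nodes makes the values agree. This turns a moving last node into the moving first
  node that \<open>divdiff\<close> differentiates.\<close>

lemma divdiff_poly_rotate:
  "divdiff_poly c b N m (\<lambda>s. (x(Suc m := w)) (Suc s)) = divdiff_poly c b N m (x(0 := w))"
proof -
  \<comment> \<open>\<open>f\<close> is the cyclic permutation of \<open>{0..m}\<close> that matches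
    the two lists: it sends the last position, where \<open>w\<close> stands on the left, to
    0.\<close>
  define f where "f = (\<lambda>s. if s = m then 0 else Suc s)"
  have inj: "inj_on f {0..m}"
    by (auto simp: inj_on_def f_def split: if_splits)
  have "f ` {0..m} \<subseteq> {0..m}"
    by (auto simp: f_def)
  then have img: "f ` {0..m} = {0..m}"
    using inj by (intro endo_inj_surj) auto
  have "complete_homogeneous {0..m} \<alpha> (\<lambda>s. (x(0 := w)) s - b)
      = complete_homogeneous {0..m} \<alpha> (\<lambda>s. (x(Suc m := w)) (Suc s) - b)" for \<alpha>
  proof -
    have "complete_homogeneous (f ` {0..m}) \<alpha> (\<lambda>s. (x(0 := w)) s - b)
        = complete_homogeneous {0..m} \<alpha> (\<lambda>s. (x(0 := w)) (f s) - b)"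
      using inj by (intro complete_homogeneous_image) auto
    also have "\<dots> = complete_homogeneous {0..m} \<alpha> (\<lambda>s. (x(Suc m := w)) (Suc s) - b)"
      by (intro complete_homogeneous_cong) (auto simp: f_def)
    finally show ?thesis
      unfolding img .
  qed
  then show ?thesis
    by (simp only: divdiff_poly_def)
qed

text \<open>By Caratheodory's criterion it suffices to write the increment as \<open>w - x 0\<close>
  times a function continuous at \<open>x 0\<close>; the difference identity supplies that
  factor.\<close>

lemma has_field_derivative_divdiff_poly:
  assumes "x (Suc m) = x 0"
  shows "((\<lambda>w. divdiff_poly c b N m (x(0 := w))) has_field_derivative
           divdiff_poly c b N (Suc m) x) (at (x 0))"
  unfolding DERIV_caratheodory_within
proof (intro exI conjI)
  \<comment> \<open>The slope function moves the extra node \<open>x (Suc m)\<close>. At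
    \<open>w = x 0\<close> the update changes nothing, because the two end nodes coincide.\<close>
  let ?g = "\<lambda>w. divdiff_poly c b N (Suc m) (x(Suc m := w))"
  show "\<forall>w. divdiff_poly c b N m (x(0 := w)) - divdiff_poly c b N m (x(0 := x 0)) = ?g w * (w - x 0)"
  proof
    fix w
    have "divdiff_poly c b N m (x(Suc m := w)) = divdiff_poly c b N m x"
      by (intro divdiff_poly_cong) simp
    then show "divdiff_poly c b N m (x(0 := w)) - divdiff_poly c b N m (x(0 := x 0))
        = ?g w * (w - x 0)"
      using divdiff_poly_diff[of c b N m "x(Suc m := w)"]
      unfolding divdiff_poly_rotate by (simp add: mult.commute)
  qed
  have upd: "continuous (at (x 0)) (\<lambda>w. (x(Suc m := w)) s)" for s
    by (cases "s = Suc m") simp_all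
  show "continuous (at (x 0)) ?g"
    unfolding divdiff_poly_def by (intro continuous_intros upd)
  show "?g (x 0) = divdiff_poly c b N (Suc m) x"
    using assms by (simp add: fun_upd_idem)
qed

text \<open>Induction on \<open>m\<close> for all node lists at once, since the recursion shifts the
  nodes or varies the first one.\<close>

lemma divdiff_eq_divdiff_poly:
  assumes "open U" and h: "\<And>z. z \<in> U \<Longrightarrow> h z = (\<Sum>\<alpha>=0..N. c \<alpha> * (z - b) ^ \<alpha>)"
    and "x ` {0..m} \<subseteq> U"
  shows "divdiff h m x = divdiff_poly c b N m x"
  using assms(3)
proof (induction m arbitrary: x)
  case 0
  have single: "complete_homogeneous {0} \<alpha> \<xi> = \<xi> 0 ^ \<alpha>" for \<alpha> \<xi>
    by (induction \<alpha>)
       (simp_all add: complete_homogeneous_0 complete_homogeneous_insert_Suc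
          complete_homogeneous_empty_Suc)
  show ?case
    using 0 by (simp add: h divdiff_poly_def single)
next
  case (Suc m)
  show ?case
  proof (cases "x (Suc m) = x 0")
    case True
    have "((\<lambda>w. divdiff h m (x(0 := w))) has_field_derivative divdiff_poly c b N (Suc m) x) (at (x 0))"
    \<comment> \<open>The induction hypothesis applies only while the moving node stays in
      \<open>U\<close>; as \<open>U\<close> is open, this already fixes the derivative at
      \<open>x 0\<close>.\<close>
    proof (rule has_field_derivative_transform_within_open)
      show "((\<lambda>w. divdiff_poly c b N m (x(0 := w))) has_field_derivative
          divdiff_poly c b N (Suc m) x) (at (x 0))"
        using True by (rule has_field_derivative_divdiff_poly)
      show "open U" "x 0 \<in> U"
        using assms(1) Suc.prems by auto
      fix w assume "w \<in> U"
      then show "divdiff_poly c b N m (x(0 := w)) = divdiff h m (x(0 := w))"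
        using Suc.prems by (intro Suc.IH[symmetric]) (auto simp: image_subset_iff)
    qed
    then show ?thesis
      using True by (simp add: DERIV_imp_deriv)
  next
    case False
    have "divdiff h m (\<lambda>s. x (Suc s)) = divdiff_poly c b N m (\<lambda>s. x (Suc s))"
      and "divdiff h m x = divdiff_poly c b N m x"
      using Suc.prems by (intro Suc.IH; auto simp: image_subset_iff)+
    then show ?thesis
      using False by (simp add: divdiff_poly_diff)
  qed
qed

section \<open>Absence of denominators\<close>

text \<open>An infinite index set does no harm: the sum is then the constant 0.\<close>

lemma division_free_sum:
  assumes "\<And>a. a \<in> I \<Longrightarrow> division_free S (p a)"
  shows "division_free S (\<lambda>\<xi>. \<Sum>a\<in>I. p a \<xi>)"
  using assms
  by (induction I rule: infinite_finite_induct) (auto intro: division_free.intros)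

lemma division_free_prod:
  assumes "\<And>a. a \<in> I \<Longrightarrow> division_free S (p a)"
  shows "division_free S (\<lambda>\<xi>. \<Prod>a\<in>I. p a \<xi>)"
  using assms
  by (induction I rule: infinite_finite_induct) (auto intro: division_free.intros)

lemma division_free_power:
  assumes "division_free S p"
  shows "division_free S (\<lambda>\<xi>. p \<xi> ^ n)"
  using assms by (induction n) (auto intro: division_free.intros)

lemma division_free_sigma_poly: "division_free {i..j} (sigma_poly \<alpha> i j)"
proof -
  have "sigma_poly \<alpha> i j = (\<lambda>\<xi>. \<Sum>e | e \<in> {i..j} \<rightarrow>\<^sub>E UNIV \<and> (\<Sum>s=i..j. e s) = \<alpha>. \<Prod>s=i..j. \<xi> s ^ e s)"
    by (simp add: fun_eq_iff sigma_poly_def)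
  then show ?thesis
    by (simp only:)
       (intro division_free_sum division_free_prod division_free_power division_free.var)
qed

theorem proposition4:
  fixes \<mu> \<xi> c :: "nat \<Rightarrow> complex" and \<mu>bar :: complex and h :: "complex \<Rightarrow> complex"
    and n l k i m :: nat and \<gamma> :: int and U :: "complex set"
  assumes "k \<ge> 1" and "l + k \<le> n" and "\<gamma> \<ge> -1"
    and "1 \<le> i" and "i + m \<le> n"
    and "\<mu>bar = (1 / of_nat k) * (\<Sum>s=l+1..l+k. \<mu> s)"
    and "\<And>s. \<xi> s = \<mu> s - \<mu>bar"
    and "\<And>\<alpha>. int \<alpha> > int k + \<gamma> \<Longrightarrow> c \<alpha> = 0"
    and "open U" and "\<mu> ` {i..i+m} \<subseteq> U"
    and "\<And>z. z \<in> U \<Longrightarrow> h z = (\<Sum>\<alpha>=0..nat (int k + \<gamma>). c \<alpha> * (z - \<mu>bar) ^ \<alpha>)"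
  shows "Delta \<mu> i (i + m) h
           = (\<Sum>\<alpha>=m..nat (int k + \<gamma>). c \<alpha> * sigma_poly (\<alpha> - m) i (i + m) \<xi>)
       \<and> (\<Sum>\<alpha>=m..nat (int k + \<gamma>). c \<alpha> * sigma_poly (\<alpha> - m) i (i + m) \<xi>)
           = c m + (\<Sum>\<alpha>=m+1..nat (int k + \<gamma>). c \<alpha> * sigma_poly (\<alpha> - m) i (i + m) \<xi>)
       \<and> division_free {i..i+m}
           (\<lambda>x. \<Sum>\<alpha>=m..nat (int k + \<gamma>). c \<alpha> * sigma_poly (\<alpha> - m) i (i + m) x)"
proof (intro conjI)
  \<comment> \<open>Since \<open>k \<ge> 1\<close> and \<open>\<gamma> \<ge> -1\<close>, the integer
    \<open>k + \<gamma>\<close> is nonnegative and \<open>nat\<close> does not truncate it.\<close>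
  define N where "N = nat (int k + \<gamma>)"
  have "complete_homogeneous {0..m} \<beta> (\<lambda>s. \<mu> (i + s) - \<mu>bar) = sigma_poly \<beta> i (i + m) \<xi>" for \<beta>
    using complete_homogeneous_image[of "{0..m}" "\<lambda>s. i + s" \<beta> \<xi>] assms(7)
    by (simp add: sigma_poly_eq_complete_homogeneous add.commute)
  moreover have "Delta \<mu> i (i + m) h = divdiff_poly c \<mu>bar N m (\<lambda>s. \<mu> (i + s))"
    unfolding Delta_def diff_add_inverse N_def using assms(9,10,11)
    by (intro divdiff_eq_divdiff_poly[of U]) (auto simp: image_subset_iff)
  ultimately show "Delta \<mu> i (i + m) h
      = (\<Sum>\<alpha>=m..nat (int k + \<gamma>). c \<alpha> * sigma_poly (\<alpha> - m) i (i + m) \<xi>)"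
    by (simp add: divdiff_poly_def N_def)
  show "(\<Sum>\<alpha>=m..nat (int k + \<gamma>). c \<alpha> * sigma_poly (\<alpha> - m) i (i + m) \<xi>)
      = c m + (\<Sum>\<alpha>=m+1..nat (int k + \<gamma>). c \<alpha> * sigma_poly (\<alpha> - m) i (i + m) \<xi>)"
  proof (cases "m \<le> nat (int k + \<gamma>)")
    case True
    then show ?thesis
      by (simp add: sum.atLeast_Suc_atMost sigma_poly_0)
  next
    \<comment> \<open>Both sums are empty here, so the equality rests on the convention that
      coefficients beyond \<open>k + \<gamma>\<close> vanish.\<close>
    case False
    then have "c m = 0"
      by (intro assms(8)) linarith
    with False show ?thesis
      by simp
  qed
  show "division_free {i..i+m}
      (\<lambda>x. \<Sum>\<alpha>=m..nat (int k + \<gamma>). c \<alpha> * sigma_poly (\<alpha> - m) i (i + m) x)"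
    by (intro division_free_sum division_free.mult division_free.const division_free_sigma_poly)
qed

end
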